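(* A displacement field $\mathbf{u}:\Omega\to\mathbb{R}^3$ is universal for the triclinic class $\mathsf{1}$ of linear strain-gradient elastic solids if and only if it is a homogeneous displacement field.
   Context: $\Omega\subset\mathbb{R}^3$ is a nonempty convex open set with Cartesian coordinates $(x_1,x_2,x_3)$. Repeated indices are summed over $1,2,3$ and a comma denotes partial differentiation. A displacement field is a smooth map $\mathbf{u}:\Omega\to\mathbb{R}^3$, with strain $e_{lm}=\tfrac12(u_{l,m}+u_{m,l})$. It is homogeneous if $\mathbf{u}(\mathbf{x})=\mathbf{H}\mathbf{x}+\mathbf{b}$ for a constant matrix $\mathbf{H}$ and constant vector $\mathbf{b}$. A strain-gradient material is a triple $(\mathsf{C},\mathsf{M},\mathsf{A})$ of constant real tensors of orders $4,5,6$ with index symmetries $\mathsf{C}_{ijlm}=\mathsf{C}_{jilm}=\mathsf{C}_{lmij}$, $\mathsf{M}_{ijklm}=\mathsf{M}_{jiklm}=\mathsf{M}_{ijlkm}$, $\mathsf{A}_{ijklmn}=\mathsf{A}_{jiklmn}=\mathsf{A}_{lmnijk}$. Its stress and hyper-stress are $\sigma_{ij}=\mathsf{C}_{ijlm}e_{lm}+\mathsf{M}_{ijlmn}e_{lm,n}$ and $\tau_{ijk}=\mathsf{M}_{lmijk}e_{lm}+\mathsf{A}_{ijklmn}e_{lm,n}$, and the equilibrium equations without body forces are $\sigma_{ij,j}-\tau_{ijk,jk}=0$ in $\Omega$ for $i=1,2,3$. The triclinic class $\mathsf{1}$ is the set of all materials $(\mathsf{C},\mathsf{M},\mathsf{A})$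 with these index symmetries ($21+108+171=300$ independent constants). A displacement field is universal for the class if it satisfies the equilibrium equations for every material in the class. *)

theory Defs
  imports "HOL-Analysis.Analysis"
begin

text \<open>The set \<open>S\<close> is meant to be open. Fields are total functions, but all notions below
  constrain them only on \<open>S\<close>: derivatives at a point of an open set are local.\<close>

fun higher_differentiable_on ::
  "nat \<Rightarrow> 'a::real_normed_vector set \<Rightarrow> ('a \<Rightarrow> 'b::real_normed_vector) \<Rightarrow> bool" where
  "higher_differentiable_on 0 S f \<longleftrightarrow> continuous_on S f"
| "higher_differentiable_on (Suc n) S f \<longleftrightarrow>
     (\<forall>x\<in>S. f differentiable (at x)) \<and>
     (\<forall>v. higher_differentiable_on n S (\<lambda>x. frechet_derivative f (at x) v))"

definition smooth_on ::
  "'a::real_normed_vector set \<Rightarrow> ('a \<Rightarrow> 'b::real_normed_vector) \<Rightarrow> bool" where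
  "smooth_on S f \<longleftrightarrow> (\<forall>n. higher_differentiable_on n S f)"

definition partial_deriv :: "(real^3 \<Rightarrow> real) \<Rightarrow> 3 \<Rightarrow> real^3 \<Rightarrow> real" where
  "partial_deriv f k x = deriv (\<lambda>t. f (x + t *\<^sub>R axis k 1)) 0"

definition displacement_field :: "(real^3) set \<Rightarrow> (real^3 \<Rightarrow> real^3) \<Rightarrow> bool" where
  "displacement_field \<Omega> u \<longleftrightarrow> smooth_on \<Omega> u"

definition homogeneous_displacement :: "(real^3) set \<Rightarrow> (real^3 \<Rightarrow> real^3) \<Rightarrow> bool" where
  "homogeneous_displacement \<Omega> u \<longleftrightarrow>
     (\<exists>(H :: real^3^3) (b :: real^3). \<forall>x\<in>\<Omega>. u x = H *v x + b)"

definition strain :: "(real^3 \<Rightarrow> real^3) \<Rightarrow> 3 \<Rightarrow> 3 \<Rightarrow> real^3 \<Rightarrow> real" where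
  "strain u l m x =
     (partial_deriv (\<lambda>y. u y $ l) m x + partial_deriv (\<lambda>y. u y $ m) l x) / 2"

text \<open>Tensors are given by their Cartesian components.\<close>

type_synonym tensor4 = "3 \<Rightarrow> 3 \<Rightarrow> 3 \<Rightarrow> 3 \<Rightarrow> real"
type_synonym tensor5 = "3 \<Rightarrow> 3 \<Rightarrow> 3 \<Rightarrow> 3 \<Rightarrow> 3 \<Rightarrow> real"
type_synonym tensor6 = "3 \<Rightarrow> 3 \<Rightarrow> 3 \<Rightarrow> 3 \<Rightarrow> 3 \<Rightarrow> 3 \<Rightarrow> real"
type_synonym tensor_triple = "tensor4 \<times> tensor5 \<times> tensor6"

definition strain_gradient_material :: "tensor_triple \<Rightarrow> bool" where
  "strain_gradient_material = (\<lambda>(C, M, A).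
     (\<forall>i j l m. C i j l m = C j i l m \<and> C i j l m = C l m i j) \<and>
     (\<forall>i j k l m. M i j k l m = M j i k l m \<and> M i j k l m = M i j l k m) \<and>
     (\<forall>i j k l m n. A i j k l m n = A j i k l m n \<and> A i j k l m n = A l m n i j k))"

definition stress :: "tensor_triple \<Rightarrow> (real^3 \<Rightarrow> real^3) \<Rightarrow> 3 \<Rightarrow> 3 \<Rightarrow> real^3 \<Rightarrow> real" where
  "stress = (\<lambda>(C, M, A) u i j x.
     (\<Sum>l\<in>UNIV. \<Sum>m\<in>UNIV. C i j l m * strain u l m x) +
     (\<Sum>l\<in>UNIV. \<Sum>m\<in>UNIV. \<Sum>n\<in>UNIV. M i j l m n * partial_deriv (strain u l m) n x))"

definition hyper_stress ::
  "tensor_triple \<Rightarrow> (real^3 \<Rightarrow> real^3) \<Rightarrow> 3 \<Rightarrow> 3 \<Rightarrow> 3 \<Rightarrow> real^3 \<Rightarrow> real" where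
  "hyper_stress = (\<lambda>(C, M, A) u i j k x.
     (\<Sum>l\<in>UNIV. \<Sum>m\<in>UNIV. M l m i j k * strain u l m x) +
     (\<Sum>l\<in>UNIV. \<Sum>m\<in>UNIV. \<Sum>n\<in>UNIV. A i j k l m n * partial_deriv (strain u l m) n x))"

definition equilibrium :: "(real^3) set \<Rightarrow> tensor_triple \<Rightarrow> (real^3 \<Rightarrow> real^3) \<Rightarrow> bool" where
  "equilibrium \<Omega> T u \<longleftrightarrow> (\<forall>i. \<forall>x\<in>\<Omega>.
     (\<Sum>j\<in>UNIV. partial_deriv (stress T u i j) j x) -
     (\<Sum>j\<in>UNIV. \<Sum>k\<in>UNIV.
        partial_deriv (partial_deriv (hyper_stress T u i j k) j) k x) = 0)"

definition triclinic_class :: "tensor_triple set" where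
  "triclinic_class = {T. strain_gradient_material T}"

definition universal_for ::
  "(real^3) set \<Rightarrow> tensor_triple set \<Rightarrow> (real^3 \<Rightarrow> real^3) \<Rightarrow> bool" where
  "universal_for \<Omega> K u \<longleftrightarrow> (\<forall>T\<in>K. equilibrium \<Omega> T u)"

end

theory Submission
  imports Defs
begin

text \<open>The classical elasticities \<open>C = S \<otimes> I + I \<otimes> S\<close> with \<open>S\<close> symmetric (and \<open>M = 0\<close>, \<open>A = 0\<close>) already
  suffice for necessity. Equilibrium reads \<open>S\<^sub>i\<^sub>j e\<^sub>l\<^sub>l\<^sub>,\<^sub>j + S\<^sub>l\<^sub>m e\<^sub>l\<^sub>m\<^sub>,\<^sub>i = 0\<close>; \<open>S = I\<close> gives \<open>e\<^sub>l\<^sub>l\<^sub>,\<^sub>i = 0\<close>, and then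
  arbitrary \<open>S\<close> gives \<open>e\<^sub>l\<^sub>m\<^sub>,\<^sub>i = 0\<close>, so the strain is a constant \<open>E\<close>. Integrating along segments,
  \<open>(u x - u y) \<bullet> (x - y) = (x - y) \<bullet> E (x - y)\<close> on the convex set \<open>\<Omega>\<close>. Differentiating this in \<open>y\<close>
  expresses \<open>u x\<close> as an affine function of \<open>x\<close>; no symmetry of second derivatives is needed.\<close>

section \<open>Partial derivatives and strain in terms of the Frechet derivative\<close>

lemma partial_deriv_eq:
  fixes f :: "real^3 \<Rightarrow> real"
  assumes "(f has_derivative f') (at x)"
  shows "partial_deriv f k x = f' (axis k 1)"
proof -
  have "((\<lambda>t. f (x + t *\<^sub>R axis k 1)) has_derivative (\<lambda>t. f' (t *\<^sub>R axis k 1))) (at 0)"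
    by (rule has_derivative_compose[where g = f]) (auto intro!: derivative_eq_intros assms)
  moreover have "f' (t *\<^sub>R axis k 1) = f' (axis k 1) * t" for t
    using linear_cmul[OF has_derivative_linear[OF assms]] by simp
  ultimately have "((\<lambda>t. f (x + t *\<^sub>R axis k 1)) has_field_derivative f' (axis k 1)) (at 0)"
    by (simp add: has_field_derivative_def)
  then show ?thesis
    unfolding partial_deriv_def by (rule DERIV_imp_deriv)
qed

text \<open>Fields are arbitrary outside \<open>S\<close>, so constancy is available only on an open
  set; derivatives are local, which makes this sufficient.\<close>

lemma partial_deriv_eq_0:
  assumes "open S" "x \<in> S" "\<And>y. y \<in> S \<Longrightarrow> f y = c"
  shows "partial_deriv f k x = 0"
proof -
  have "(f has_derivative (\<lambda>_. 0)) (at x)"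
    by (rule has_derivative_transform_within_open[OF has_derivative_const assms(1,2)])
       (simp add: assms(3))
  then show ?thesis by (simp add: partial_deriv_eq)
qed

lemma linear_eq_0_if_axis:
  fixes f :: "real^'n \<Rightarrow> 'b::real_vector"
  assumes "linear f" "\<And>k. f (axis k 1) = 0"
  shows "f = (\<lambda>_. 0)"
proof
  fix v :: "real^'n"
  have "f v = f (\<Sum>k\<in>UNIV. (v $ k) *\<^sub>R axis k 1)"
    by (simp add: basis_expansion scalar_mult_eq_scaleR[symmetric])
  also have "\<dots> = 0"
    by (simp add: linear_sum[OF assms(1)] linear_cmul[OF assms(1)] assms(2))
  finally show "f v = 0" .
qed

lemma partial_deriv_component:
  fixes u :: "real^3 \<Rightarrow> real^3"
  assumes "(u has_derivative u') (at x)"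
  shows "partial_deriv (\<lambda>y. u y $ l) m x = u' (axis m 1) $ l"
  by (rule partial_deriv_eq)
     (rule bounded_linear.has_derivative[OF bounded_linear_vec_nth assms])

lemma strain_eq:
  assumes "(u has_derivative u') (at x)"
  shows "strain u l m x = (u' (axis m 1) $ l + u' (axis l 1) $ m) / 2"
  by (simp add: strain_def partial_deriv_component[OF assms])

lemma strain_commute: "strain u l m = strain u m l"
  by (rule ext) (simp add: strain_def add.commute)

lemma smooth_on_has_derivative:
  assumes "smooth_on S f" "x \<in> S"
  shows "(f has_derivative frechet_derivative f (at x)) (at x)"
proof -
  have "higher_differentiable_on (Suc 0) S f"
    using assms(1) unfolding smooth_on_def by blast
  then show ?thesis
    using assms(2) by (simp add: frechet_derivative_works)
qed

lemma smooth_on_differentiable_frechet_derivative: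
  assumes "smooth_on S f" "x \<in> S"
  shows "(\<lambda>y. frechet_derivative f (at y) v) differentiable (at x)"
proof -
  have "higher_differentiable_on (Suc (Suc 0)) S f"
    using assms(1) unfolding smooth_on_def by blast
  then show ?thesis
    using assms(2) by simp
qed

text \<open>On \<open>S\<close> the strain coincides with the symmetrised components of the Frechet
  derivative of \<open>u\<close>, to which second-order smoothness applies. Openness of
  \<open>S\<close> transfers the derivative back to \<open>strain\<close>.\<close>

lemma strain_differentiable:
  assumes "open S" "smooth_on S u" "x \<in> S"
  shows "strain u l m differentiable (at x)"
proof -
  let ?g = "\<lambda>y. (frechet_derivative u (at y) (axis m 1) $ l
              + frechet_derivative u (at y) (axis l 1) $ m) / 2"
  have "?g differentiable (at x)"
    by (intro differentiable_divide differentiable_add differentiable_const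
        differentiable_compose[OF bounded_linear_imp_differentiable[OF bounded_linear_vec_nth]]
        smooth_on_differentiable_frechet_derivative[OF assms(2,3)]) simp
  then obtain g' where "(?g has_derivative g') (at x)"
    unfolding differentiable_def by blast
  then have "(strain u l m has_derivative g') (at x)"
    by (rule has_derivative_transform_within_open[OF _ assms(1,3)])
       (simp add: strain_eq[OF smooth_on_has_derivative[OF assms(2)]])
  then show ?thesis
    unfolding differentiable_def by blast
qed

section \<open>Necessity: the strain is constant\<close>

text \<open>With vanishing \<open>M\<close> and \<open>A\<close> the hyper-stress is identically
  zero and the stress is linear in the strain, so differentiability of the strain lets the
  divergence pass through the sums.\<close>

lemma equilibrium_classical:
  assumes "open S" "smooth_on S u" "equilibrium S (C, \<lambda>_ _ _ _ _. 0, \<lambda>_ _ _ _ _ _. 0) u" "x \<in> S"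
  shows "(\<Sum>j\<in>UNIV. \<Sum>l\<in>UNIV. \<Sum>m\<in>UNIV. C i j l m * partial_deriv (strain u l m) j x) = 0"
proof -
  let ?T = "(C, \<lambda>_ _ _ _ _. 0, \<lambda>_ _ _ _ _ _. 0) :: tensor_triple"
  have der: "(strain u l m has_derivative frechet_derivative (strain u l m) (at x)) (at x)" for l m
    using strain_differentiable[OF assms(1,2,4)] frechet_derivative_works by blast
  have "partial_deriv (stress ?T u i j) j x
      = (\<Sum>l\<in>UNIV. \<Sum>m\<in>UNIV. C i j l m * partial_deriv (strain u l m) j x)" for j
  proof -
    have "(stress ?T u i j has_derivative
        (\<lambda>h. \<Sum>l\<in>UNIV. \<Sum>m\<in>UNIV. C i j l m * frechet_derivative (strain u l m) (at x) h)) (at x)"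
      unfolding stress_def by (auto intro!: has_derivative_sum has_derivative_mult_right der)
    then show ?thesis
      by (simp add: partial_deriv_eq[OF der] partial_deriv_eq)
  qed
  moreover have "partial_deriv (partial_deriv (hyper_stress ?T u i j k) j) k x = 0" for j k
    by (intro partial_deriv_eq_0[OF open_UNIV UNIV_I, where c = 0]) (simp add: hyper_stress_def)
  moreover have "(\<Sum>j\<in>UNIV. partial_deriv (stress ?T u i j) j x) -
      (\<Sum>j\<in>UNIV. \<Sum>k\<in>UNIV. partial_deriv (partial_deriv (hyper_stress ?T u i j k) j) k x) = 0"
    using assms(3,4) unfolding equilibrium_def by blast
  ultimately show ?thesis by simp
qed

lemma strain_gradient_eq_0_if_universal:
  assumes "open \<Omega>" "smooth_on \<Omega> u" "universal_for \<Omega> triclinic_class u" "x \<in> \<Omega>"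
  shows "partial_deriv (strain u a b) i x = 0"
proof -
  define D where "D l m j = partial_deriv (strain u l m) j x" for l m j
  define \<delta> :: "3 \<Rightarrow> 3 \<Rightarrow> real" where "\<delta> i j = (if i = j then 1 else 0)" for i j
  have \<delta>_sum: "(\<Sum>j\<in>UNIV. \<delta> i j * f j) = f i" for i f
    by (simp add: \<delta>_def if_distrib[of "\<lambda>z. z * _"] cong: if_cong)
  have \<delta>_commute: "\<delta> i j = \<delta> j i" for i j
    by (simp add: \<delta>_def)
  have eq: "(\<Sum>j\<in>UNIV. S i j * (\<Sum>l\<in>UNIV. D l l j)) + (\<Sum>l\<in>UNIV. \<Sum>m\<in>UNIV. S l m * D l m i) = 0"
    if S: "\<And>i j. S i j = S j i" for S i
  proof -
    let ?C = "\<lambda>i j l m. S i j * \<delta> l m + \<delta> i j * S l m"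
    have "?C i j l m = ?C j i l m" "?C i j l m = ?C l m i j" for i j l m
      by (simp_all add: S[of i j] \<delta>_commute[of i j])
    then have "strain_gradient_material (?C, \<lambda>_ _ _ _ _. 0, \<lambda>_ _ _ _ _ _. 0)"
      unfolding strain_gradient_material_def by blast
    then have "equilibrium \<Omega> (?C, \<lambda>_ _ _ _ _. 0, \<lambda>_ _ _ _ _ _. 0) u"
      using assms(3) unfolding universal_for_def triclinic_class_def by blast
    from equilibrium_classical[OF assms(1,2) this assms(4), of i]
    have "0 = (\<Sum>j\<in>UNIV. \<Sum>l\<in>UNIV. \<Sum>m\<in>UNIV. ?C i j l m * D l m j)"
      by (simp add: D_def)
    also have "\<dots> = (\<Sum>j\<in>UNIV. S i j * (\<Sum>l\<in>UNIV. \<Sum>m\<in>UNIV. \<delta> l m * D l m j))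
        + (\<Sum>j\<in>UNIV. \<delta> i j * (\<Sum>l\<in>UNIV. \<Sum>m\<in>UNIV. S l m * D l m j))"
      by (simp add: distrib_right sum.distrib sum_distrib_left mult.assoc)
    finally show ?thesis by (simp add: \<delta>_sum)
  qed
  \<comment> \<open>For \<open>S = \<delta>\<close> both sums in \<open>eq\<close> reduce to the
    derivative of the trace, so twice it vanishes.\<close>
  have trace: "(\<Sum>l\<in>UNIV. D l l j) = 0" for j
    using eq[of \<delta> j, OF \<delta>_commute] by (simp add: \<delta>_sum)
  \<comment> \<open>Since \<open>eq\<close> admits only symmetric \<open>S\<close>, the entry at
    \<open>a\<close>, \<open>b\<close> is picked out by a symmetrised matrix unit. This yields
    \<open>D a b i + D b a i\<close>, and the two terms agree because the strain is
    symmetric.\<close>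
  have "(\<Sum>l\<in>UNIV. \<Sum>m\<in>UNIV. (\<delta> a l * \<delta> b m + \<delta> b l * \<delta> a m) * D l m i) = 0"
    using eq[of "\<lambda>l m. \<delta> a l * \<delta> b m + \<delta> b l * \<delta> a m" i] by (simp add: trace algebra_simps)
  also have "(\<Sum>l\<in>UNIV. \<Sum>m\<in>UNIV. (\<delta> a l * \<delta> b m + \<delta> b l * \<delta> a m) * D l m i)
      = (\<Sum>l\<in>UNIV. \<delta> a l * (\<Sum>m\<in>UNIV. \<delta> b m * D l m i))
      + (\<Sum>l\<in>UNIV. \<delta> b l * (\<Sum>m\<in>UNIV. \<delta> a m * D l m i))"
    by (simp add: distrib_right sum.distrib sum_distrib_left mult.assoc)
  also have "\<dots> = 2 * D a b i"
    by (simp add: \<delta>_sum D_def strain_commute[of u b a])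
  finally show ?thesis by (simp add: D_def)
qed

lemma strain_constant_if_gradient_eq_0:
  assumes "open \<Omega>" "convex \<Omega>" "smooth_on \<Omega> u"
    and "\<And>x k. x \<in> \<Omega> \<Longrightarrow> partial_deriv (strain u l m) k x = 0"
  shows "\<exists>c. \<forall>x\<in>\<Omega>. strain u l m x = c"
proof -
  have "(strain u l m has_derivative (\<lambda>_. 0)) (at x within \<Omega>)" if "x \<in> \<Omega>" for x
  proof -
    obtain f' where f': "(strain u l m has_derivative f') (at x)"
      using strain_differentiable[OF assms(1,3) \<open>x \<in> \<Omega>\<close>] unfolding differentiable_def by blast
    have "f' (axis k 1) = 0" for k
      using assms(4)[OF \<open>x \<in> \<Omega>\<close>] by (simp add: partial_deriv_eq[OF f'])
    then have "f' = (\<lambda>_. 0)"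
      by (rule linear_eq_0_if_axis[OF has_derivative_linear[OF f']])
    then show ?thesis
      using f' has_derivative_at_withinI by blast
  qed
  from has_derivative_zero_constant[OF assms(2) this] show ?thesis by blast
qed

section \<open>Integrating a constant strain\<close>

lemma affine_if_strain_constant:
  fixes u :: "real^3 \<Rightarrow> real^3" and E :: "3 \<Rightarrow> 3 \<Rightarrow> real"
  assumes "open \<Omega>" "convex \<Omega>"
    and u: "\<And>x. x \<in> \<Omega> \<Longrightarrow> (u has_derivative u' x) (at x)"
    and E: "\<And>x l m. x \<in> \<Omega> \<Longrightarrow> strain u l m x = E l m"
  shows "homogeneous_displacement \<Omega> u"
proof (cases "\<Omega> = {}")
  case True
  then show ?thesis by (simp add: homogeneous_displacement_def)
next
  case False
  then obtain p where p: "p \<in> \<Omega>" by blast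
  define B :: "real^3^3" where "B = (\<chi> l m. E l m)"
  \<comment> \<open>\<open>B\<close> is the symmetric part of the Jacobian at every point of
    \<open>\<Omega>\<close>; the skew part, which the strain does not control, drops out of the
    quadratic form.\<close>
  have u'_quadratic: "u' z d \<bullet> d = d \<bullet> (B *v d)" if z: "z \<in> \<Omega>" for z d
  proof -
    let ?G = "matrix (u' z)"
    have "linear (u' z)"
      using u[OF z] by (rule has_derivative_linear)
    then have G: "u' z v = ?G *v v" for v
      by (simp add: matrix_works)
    have "B = (1/2) *\<^sub>R (?G + transpose ?G)"
      by (simp add: B_def vec_eq_iff E[OF z, symmetric] strain_eq[OF u[OF z]] transpose_def matrix_def)
    then have "d \<bullet> (B *v d) = (d \<bullet> (?G *v d) + d \<bullet> (transpose ?G *v d)) / 2"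
      by (simp add: scaleR_matrix_vector_assoc[symmetric] matrix_vector_mult_add_rdistrib inner_add_right)
    also have "d \<bullet> (transpose ?G *v d) = d \<bullet> (?G *v d)"
      by (metis dot_lmul_matrix inner_commute transpose_matrix_vector)
    finally show ?thesis by (simp add: G inner_commute)
  qed
  have quadratic: "(u x - u y) \<bullet> (x - y) = (x - y) \<bullet> (B *v (x - y))" if "x \<in> \<Omega>" "y \<in> \<Omega>" for x y
  proof -
    define d where "d = x - y"
    have seg: "y + t *\<^sub>R d \<in> \<Omega>" if "0 \<le> t" "t \<le> 1" for t
    proof -
      have "y + t *\<^sub>R d = (1 - t) *\<^sub>R y + t *\<^sub>R x"
        by (simp add: d_def algebra_simps)
      then show ?thesis
        using \<open>convex \<Omega>\<close> \<open>x \<in> \<Omega>\<close> \<open>y \<in> \<Omega>\<close> that by (simp add: convex_alt)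
    qed
    have der: "((\<lambda>t. u (y + t *\<^sub>R d) \<bullet> d) has_real_derivative d \<bullet> (B *v d)) (at t)"
      if t: "0 \<le> t" "t \<le> 1" for t
    proof -
      have "((\<lambda>t. u (y + t *\<^sub>R d)) has_derivative (\<lambda>s. u' (y + t *\<^sub>R d) (s *\<^sub>R d))) (at t)"
        by (rule has_derivative_compose[where g = u]) (auto intro!: derivative_eq_intros u seg t)
      then have "((\<lambda>t. u (y + t *\<^sub>R d) \<bullet> d) has_derivative
          (\<lambda>s. u' (y + t *\<^sub>R d) (s *\<^sub>R d) \<bullet> d)) (at t)"
        by (rule has_derivative_inner_left)
      moreover have "u' (y + t *\<^sub>R d) (s *\<^sub>R d) \<bullet> d = d \<bullet> (B *v d) * s" for s
        using linear_cmul[OF has_derivative_linear[OF u[OF seg[OF t]]]]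
        by (simp add: u'_quadratic[OF seg[OF t]])
      ultimately show ?thesis
        by (simp add: has_field_derivative_def)
    qed
    \<comment> \<open>The component of \<open>u\<close> along \<open>d\<close> has constant
      derivative on the segment, so the mean value theorem gives the exact increment wherever the
      intermediate point lies.\<close>
    obtain t where "u (y + 1 *\<^sub>R d) \<bullet> d - u (y + 0 *\<^sub>R d) \<bullet> d = (1 - 0) * (d \<bullet> (B *v d))"
      using MVT2[of 0 1 "\<lambda>t. u (y + t *\<^sub>R d) \<bullet> d" "\<lambda>_. d \<bullet> (B *v d)"] der by auto
    then show ?thesis
      by (simp add: d_def inner_diff_left)
  qed
  \<comment> \<open>The formula comes from differentiating \<open>quadratic\<close> in
    \<open>y\<close> at \<open>p\<close> in the direction \<open>axis k 1\<close> and solving for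
    component \<open>k\<close> of \<open>u x - u p\<close>, with \<open>d = x - p\<close>. The
    derivative of \<open>u\<close> enters only at the fixed point \<open>p\<close>, so the result is
    linear in \<open>d\<close>.\<close>
  define L where "L d = (\<chi> k. axis k 1 \<bullet> (B *v d) + d \<bullet> (B *v axis k 1) - u' p (axis k 1) \<bullet> d)" for d
  have "linear L"
    by (rule linearI) (simp_all add: L_def vec_eq_iff matrix_vector_right_distrib
        matrix_vector_mult_scaleR inner_add_left inner_add_right algebra_simps)
  have "u x = u p + L (x - p)" if x: "x \<in> \<Omega>" for x
  proof -
    \<comment> \<open>By \<open>quadratic\<close>, \<open>?F\<close> vanishes throughout
      \<open>\<Omega>\<close>. Computing its derivative at \<open>p\<close> also by the product rule
      and comparing gives \<open>F\<close>.\<close>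
    let ?F = "\<lambda>y. (u x - u y) \<bullet> (x - y) - (x - y) \<bullet> (B *v (x - y))"
    have "((\<lambda>y. B *v (x - y)) has_derivative (\<lambda>h. B *v (- h))) (at p)"
      by (rule bounded_linear.has_derivative[OF matrix_vector_mul_bounded_linear])
         (auto intro!: derivative_eq_intros)
    then have "(?F has_derivative (\<lambda>h. (u x - u p) \<bullet> (- h) + (- u' p h) \<bullet> (x - p)
        - ((x - p) \<bullet> (B *v (- h)) + (- h) \<bullet> (B *v (x - p))))) (at p)"
      by (auto intro!: derivative_eq_intros u p)
    moreover have "(?F has_derivative (\<lambda>_. 0)) (at p)"
      by (rule has_derivative_transform_within_open[OF has_derivative_const \<open>open \<Omega>\<close> p])
         (simp add: quadratic[OF x])
    ultimately have "(\<lambda>h. (u x - u p) \<bullet> (- h) + (- u' p h) \<bullet> (x - p)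
        - ((x - p) \<bullet> (B *v (- h)) + (- h) \<bullet> (B *v (x - p)))) = (\<lambda>_. 0)"
      by (rule has_derivative_unique)
    from fun_cong[OF this] have F: "(u x - u p) \<bullet> h
        = h \<bullet> (B *v (x - p)) + (x - p) \<bullet> (B *v h) - u' p h \<bullet> (x - p)" for h
      by (simp add: algebra_simps linear_neg[OF matrix_vector_mul_linear])
    have "(u x - u p) $ k = L (x - p) $ k" for k
      using F[of "axis k 1"] by (simp add: L_def inner_axis)
    then show ?thesis
      by (simp add: vec_eq_iff algebra_simps)
  qed
  then have "u x = matrix L *v x + (u p - matrix L *v p)" if "x \<in> \<Omega>" for x
    using that \<open>linear L\<close> by (simp add: matrix_works linear_diff)
  then show ?thesis
    unfolding homogeneous_displacement_def by blast
qed

section \<open>Sufficiency: homogeneous fields are in equilibrium\<close>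

text \<open>An affine field has constant strain, hence constant stress and hyper-stress on
  \<open>\<Omega>\<close> for every triple \<open>T\<close>, and each term of the equilibrium
  equations vanishes separately.\<close>

lemma universal_for_if_homogeneous:
  assumes "open \<Omega>" "homogeneous_displacement \<Omega> u"
  shows "universal_for \<Omega> K u"
proof -
  obtain H :: "real^3^3" and b where u: "\<And>x. x \<in> \<Omega> \<Longrightarrow> u x = H *v x + b"
    using assms(2) unfolding homogeneous_displacement_def by blast
  have der: "(u has_derivative (\<lambda>v. H *v v)) (at x)" if "x \<in> \<Omega>" for x
  proof -
    have "((\<lambda>x. H *v x + b) has_derivative (\<lambda>v. H *v v)) (at x)"
      using has_derivative_add[OF bounded_linear_imp_has_derivative[OF matrix_vector_mul_bounded_linear]
          has_derivative_const, of H b "at x"] by simp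
    then show ?thesis
      by (rule has_derivative_transform_within_open[OF _ assms(1) that]) (simp add: u)
  qed
  have E: "strain u l m x = ((H *v axis m 1) $ l + (H *v axis l 1) $ m) / 2"
    if "x \<in> \<Omega>" for l m x
    by (rule strain_eq[OF der[OF that]])
  have D: "partial_deriv (strain u l m) n x = 0" if "x \<in> \<Omega>" for l m n x
    by (rule partial_deriv_eq_0[OF assms(1) that E])
  have "equilibrium \<Omega> T u" for T
  proof -
    obtain C M A where T: "T = (C, M, A)" by (cases T)
    have "partial_deriv (stress T u i j) k x = 0" if "x \<in> \<Omega>" for i j k x
      by (rule partial_deriv_eq_0[OF assms(1) that]) (simp add: T stress_def E D)
    moreover have "partial_deriv (hyper_stress T u i j k) n x = 0" if "x \<in> \<Omega>" for i j k n x
      by (rule partial_deriv_eq_0[OF assms(1) that]) (simp add: T hyper_stress_def E D)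
    then have "partial_deriv (partial_deriv (hyper_stress T u i j k) n) n' x = 0"
      if "x \<in> \<Omega>" for i j k n n' x
      by (rule partial_deriv_eq_0[OF assms(1) that])
    ultimately show ?thesis
      by (simp add: equilibrium_def)
  qed
  then show ?thesis by (simp add: universal_for_def)
qed

theorem proposition3p1:
  fixes \<Omega> :: "(real^3) set" and u :: "real^3 \<Rightarrow> real^3"
  assumes "open \<Omega>" and "convex \<Omega>" and "\<Omega> \<noteq> {}"
    and "displacement_field \<Omega> u"
  shows "universal_for \<Omega> triclinic_class u \<longleftrightarrow> homogeneous_displacement \<Omega> u"
proof
  assume univ: "universal_for \<Omega> triclinic_class u"
  have smooth: "smooth_on \<Omega> u"
    using assms(4) by (simp add: displacement_field_def)
  have "\<exists>c. \<forall>x\<in>\<Omega>. strain u l m x = c" for l m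
    by (rule strain_constant_if_gradient_eq_0[OF assms(1,2) smooth])
       (rule strain_gradient_eq_0_if_universal[OF assms(1) smooth univ])
  then obtain E where "\<And>x l m. x \<in> \<Omega> \<Longrightarrow> strain u l m x = E l m"
    by metis
  then show "homogeneous_displacement \<Omega> u"
    using affine_if_strain_constant[OF assms(1,2) smooth_on_has_derivative[OF smooth]] by blast
next
  assume "homogeneous_displacement \<Omega> u"
  then show "universal_for \<Omega> triclinic_class u"
    by (rule universal_for_if_homogeneous[OF assms(1)])
qed

end
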